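(* The only triple of positive integers $(x,y,z)$ with $y$ prime satisfying $$3^x = \frac{y^z-1}{y-1}$$ is $x = 1$, $y = 2$, $z = 2$. *)

theory Defs
  imports Complex_Main "HOL-Computational_Algebra.Primes"
begin

end

theory Submission
  imports Defs "HOL-Number_Theory.Cong"
begin

text \<open>
  Let \<open>S = 1 + y + \<dots> + y^(z - 1) = 3^x\<close>. Reduction modulo 3 shows \<open>3 \<noteq> y\<close>; that \<open>3 dvd z\<close>
  if \<open>y\<close> is 1 modulo 3; and that \<open>z\<close> is even if \<open>y\<close> is 2 modulo 3. In the first case
  \<open>1 + y + y^2\<close> divides \<open>S\<close>, so it is a power of 3; being 3 modulo 9 it equals 3, which is absurd.
  In the second case \<open>1 + y\<close> divides \<open>S\<close>, so it is odd and the prime \<open>y\<close> is 2; then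
  \<open>2^z = 3^x + 1\<close> is 2 or 4 modulo 8.
\<close>

text \<open>Cut into \<open>k\<close> blocks of length \<open>m\<close>, the long sum consists of
  the multiples \<open>y ^ (m * j)\<close> of the short one.\<close>

lemma geometric_sum_dvd:
  fixes y :: "'a::comm_semiring_1"
  shows "(\<Sum>i<m. y ^ i) dvd (\<Sum>i<m * k. y ^ i)"
proof (induction k)
  case (Suc k)
  have "(\<Sum>i<m * k + n. y ^ i) = (\<Sum>i<m * k. y ^ i) + y ^ (m * k) * (\<Sum>i<n. y ^ i)" for n
    by (induction n) (simp_all add: algebra_simps power_add)
  then show ?case
    using Suc by (simp add: add.commute[of m])
qed simp

lemma three_power_mod_8: "(3::nat) ^ x mod 8 \<in> {1, 3}"
proof (induction x)
  case (Suc x)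
  have "3 ^ Suc x mod 8 = 3 * (3 ^ x mod 8) mod (8::nat)"
    by (simp add: mod_mult_right_eq)
  with Suc show ?case
    by auto
qed simp

lemma power_2_eq_Suc_power_3_imp_le:
  assumes "(2::nat) ^ z = Suc (3 ^ x)"
  shows "z \<le> 2"
proof (rule ccontr)
  assume "\<not> z \<le> 2"
  then have "(2::nat) ^ 3 dvd 2 ^ z"
    by (intro le_imp_power_dvd) simp
  then have "Suc (3 ^ x) mod 8 = (0::nat)"
    using assms by simp
  then show False
    using three_power_mod_8[of x] by (auto simp: mod_Suc)
qed

text \<open>For \<open>y = 1\<close> the sum is \<open>z\<close>, possibly a power of 3, and for
  \<open>x = 0\<close> the choice \<open>z = 1\<close> gives equality; hence both
  exclusions.\<close>

lemma geometric_sum_ne_power_3_if_mod_1: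
  fixes y :: nat
  assumes "y mod 3 = 1" "y \<noteq> 1" "0 < x"
  shows "(\<Sum>i<z. y ^ i) \<noteq> 3 ^ x"
proof
  assume sum: "(\<Sum>i<z. y ^ i) = 3 ^ x"
  \<comment> \<open>Every term is 1 modulo 3, so the sum is congruent to the number of
    terms.\<close>
  have "[(\<Sum>i<z. y ^ i) = (\<Sum>i<z. 1 ^ i)] (mod 3)"
    using assms by (intro cong_sum cong_pow) (simp add: cong_def)
  then have "3 dvd z"
    using sum cong_dvd_iff[of "3 ^ x" z 3] \<open>0 < x\<close> by simp
  then obtain k where "z = 3 * k" ..
  then have "(\<Sum>i<3. y ^ i) dvd 3 ^ x"
    using geometric_sum_dvd[of y 3 k] sum by simp
  then have "y\<^sup>2 + y + 1 dvd 3 ^ x"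
    by (simp add: eval_nat_numeral add_ac)
  then obtain j where j: "y\<^sup>2 + y + 1 = 3 ^ j"
    using divides_primepow_nat[of 3 "y\<^sup>2 + y + 1" x] by auto
  obtain t where t: "y = 3 * t + 1"
    using assms(1) by (metis mult_div_mod_eq)
  with assms have "0 < t" by simp
  have nine: "y\<^sup>2 + y + 1 = 3 + 9 * (t\<^sup>2 + t)"
    by (simp add: t power2_eq_square algebra_simps)
  \<comment> \<open>As \<open>0 < t\<close>, the value exceeds 3, which rules out the exponents 0
    and 1.\<close>
  have "2 \<le> j"
  proof (rule ccontr)
    assume "\<not> 2 \<le> j"
    then have "j = 0 \<or> j = 1" by auto
    with j nine \<open>0 < t\<close> show False by auto
  qed
  then have "(3::nat) ^ 2 dvd 3 ^ j"
    by (rule le_imp_power_dvd)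
  then have "9 dvd 3 + 9 * (t\<^sup>2 + t)"
    using j nine by simp
  then show False
    by presburger
qed

lemma geometric_sum_prime_eq_power_3:
  fixes y :: nat
  assumes "prime y" "0 < x" and sum: "(\<Sum>i<z. y ^ i) = 3 ^ x"
  shows "x = 1 \<and> y = 2 \<and> z = 2"
proof -
  \<comment> \<open>The geometric sum formula, rearranged so that \<open>y ^ z - 1\<close> and the
    quotient do not occur; modulo 3 it forces \<open>y ^ z\<close> to be 1.\<close>
  have minus: "Suc (3 ^ x * (y - 1)) = y ^ z"
  proof -
    have "1 + (\<Sum>i<z. y ^ i) * (y - 1) = y ^ z"
    proof (induction z)
      case (Suc z)
      obtain u where "y = Suc u"
        using \<open>prime y\<close> prime_gt_0_nat by (metis Suc_pred)
      then show ?case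
        using Suc by (simp add: algebra_simps)
    qed simp
    then show ?thesis
      using sum by simp
  qed
  have z: "0 < z"
    using sum by (cases z) auto
  have "[Suc (3 ^ x * (y - 1)) = 1] (mod 3)"
    using \<open>0 < x\<close> by (cases x) (simp_all add: cong_def mod_Suc)
  then have pow: "[y ^ z = 1] (mod 3)"
    using minus by simp
  have "y mod 3 \<noteq> 0"
  proof
    assume "y mod 3 = 0"
    then have "3 dvd y ^ z"
      using z dvd_trans[of 3 y "y ^ z"] by (simp add: mod_0_imp_dvd)
    then show False
      using pow by (simp add: cong_def dvd_eq_mod_eq_0)
  qed
  moreover have "y mod 3 \<noteq> 1"
    using geometric_sum_ne_power_3_if_mod_1[of y x z] assms not_prime_1 by blast
  ultimately have "y mod 3 = 2" by presburger
  have "even z"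
  proof (rule ccontr)
    assume "odd z"
    then obtain k where k: "z = 2 * k + 1" by (rule oddE)
    \<comment> \<open>Since \<open>y\<close> is -1 modulo 3, its square is 1 and an odd power is
      again 2.\<close>
    have "[y * (y\<^sup>2) ^ k = 2 * 1 ^ k] (mod 3)"
      using \<open>y mod 3 = 2\<close>
      by (intro cong_mult cong_pow)
        (simp_all add: cong_def power2_eq_square mod_mult_eq[of y 3 y, symmetric])
    then have "[y ^ z = 2] (mod 3)"
      by (simp add: k power_mult)
    with pow show False
      by (simp add: cong_def)
  qed
  then obtain k where "z = 2 * k" ..
  then have "(\<Sum>i<2. y ^ i) dvd 3 ^ x"
    using geometric_sum_dvd[of y 2 k] sum by simp
  then have "Suc y dvd 3 ^ x"
    by (simp add: eval_nat_numeral)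
  then have "odd (Suc y)"
    using dvd_trans[of 2 "Suc y" "3 ^ x"] by auto
  then have y: "y = 2"
    using \<open>prime y\<close> primes_dvd_imp_eq[OF two_is_prime_nat, of y] by simp
  then have "z \<le> 2"
    using minus power_2_eq_Suc_power_3_imp_le[of z x] by simp
  with z \<open>even z\<close> have "z = 2"
    by (auto simp: le_Suc_eq numeral_2_eq_2)
  then have "(3::nat) ^ x = 3 ^ 1"
    using sum y by (simp add: eval_nat_numeral)
  then have "x = 1"
    by (subst (asm) power_inject_exp) simp_all
  with y \<open>z = 2\<close> show ?thesis by simp
qed

theorem mainTheorem6:
  shows "{(x :: nat, y :: nat, z :: nat). 0 < x \<and> 0 < y \<and> 0 < z \<and> prime y \<and>
      (3::real) ^ x = (real y ^ z - 1) / (real y - 1)} = {(1, 2, 2)}"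
proof -
  have "x = 1 \<and> y = 2 \<and> z = 2"
    if "0 < x" "prime y" and eq: "(3::real) ^ x = (real y ^ z - 1) / (real y - 1)" for x y z :: nat
  proof -
    \<comment> \<open>With a nonzero denominator the quotient is a true geometric sum, whose terms
      are naturals, so the equation descends to \<open>nat\<close>.\<close>
    have "real y \<noteq> 1"
      using prime_gt_1_nat[OF \<open>prime y\<close>] by simp
    then have "real (\<Sum>i<z. y ^ i) = real (3 ^ x)"
      using eq geometric_sum[of "real y" z] by simp
    then have "(\<Sum>i<z. y ^ i) = 3 ^ x"
      by (simp only: of_nat_eq_iff)
    then show ?thesis
      using geometric_sum_prime_eq_power_3 that by blast
  qed
  then show ?thesis
    by auto
qed

end
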